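(* Let $X_0,\dots,X_{n-1}$ be observations from a strictly stationary process with continuous marginal distribution function. For any $\omega\in\mathcal{F}_n:=\{2\pi j/n:j=1,\dots,\lfloor\frac{n-1}2\rfloor\}$, $$I_{n,\beta}(\omega):=\int_{[0,1]^2}I^{u,v}_{n,R}(\omega)\,d\mu_\beta(u,v)=\frac1{2\pi}\sum_{|k|<n}\frac{n-|k|}n e^{i\omega k}\hat\beta_n^k$$ and $$I_{n,\Gamma}(\omega):=\int_{[0,1]^2}I^{u,v}_{n,R}(\omega)\,d\mu_\Gamma(u,v)=\frac1{2\pi}\sum_{|k|<n}\frac{n-|k|}n e^{i\omega k}\hat\Gamma_n^k.$$
   Context: Notation. $I\{\cdot\}$ is the indicator function; $R_{n;t}=n\hat F_n(X_t)$ is the rank of $X_t$ among $X_0,\dots,X_{n-1}$, where $\hat F_n(x):=n^{-1}\sum_{t=0}^{n-1}I\{X_t\le x\}$. The rank-based copula periodogram is $$I^{\tau_1,\tau_2}_{n,R}(\omega):=\frac1{2\pi n}d^{\tau_1}_{n,R}(\omega)d^{\tau_2}_{n,R}(-\omega),\qquad d^\tau_{n,R}(\omega):=\sum_{t=0}^{n-1}I\{R_{n;t}\le n\tau\}e^{-i\omega t}.$$ The sample Blomqvist and Gini coefficients at lag $k$ ($|k|<n$) are $$\hat\beta_n^k:=\frac1{n-|k|}\sum_{t=0}^{n-|k|-1}\big(4I\{R_{n;t}\le n/2,\,R_{n;t+|k|}\le n/2\}-1\big),$$ $$\hat\Gamma_n^k:=\frac2{n(n-|k|)}\sum_{t=0}^{n-|k|-1}\big(|R_{n;t}+R_{n;t+|k|}-n|-|R_{n;t}-R_{n;t+|k|}|\big).$$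 The measure $\mu_\beta$ puts mass $4$ at the point $(1/2,1/2)$. The measure $\mu_\Gamma$ puts (uniformly distributed) mass $4$ on each of the sets $\{(u,u):u\in[0,1]\}$ and $\{(u,1-u):u\in[0,1]\}$, i.e. $\int g\,d\mu_\Gamma=4\int_0^1g(u,u)\,du+4\int_0^1g(u,1-u)\,du$. *)

theory Defs
  imports "HOL-Probability.Probability"
begin

definition strictly_stationary :: "'a measure \<Rightarrow> (int \<Rightarrow> 'a \<Rightarrow> real) \<Rightarrow> bool" where
  "strictly_stationary M X \<longleftrightarrow>
     (\<forall>t. X t \<in> borel_measurable M) \<and>
     (\<forall>J h. finite J \<longrightarrow>
        distr M (Pi\<^sub>M J (\<lambda>_. borel)) (\<lambda>w. \<lambda>t\<in>J. X (t + h) w) =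
        distr M (Pi\<^sub>M J (\<lambda>_. borel)) (\<lambda>w. \<lambda>t\<in>J. X t w))"

text \<open>In what follows \<open>x :: nat \<Rightarrow> real\<close> is a realisation of the observations; only
  \<open>x 0, \<dots>, x (n - 1)\<close> are used.\<close>

definition ecdf :: "nat \<Rightarrow> (nat \<Rightarrow> real) \<Rightarrow> real \<Rightarrow> real" where
  "ecdf n x y = (1 / real n) * (\<Sum>t<n. of_bool (x t \<le> y))"

definition sample_rank :: "nat \<Rightarrow> (nat \<Rightarrow> real) \<Rightarrow> nat \<Rightarrow> real" where
  "sample_rank n x t = real n * ecdf n x (x t)"

definition rank_dft :: "nat \<Rightarrow> (nat \<Rightarrow> real) \<Rightarrow> real \<Rightarrow> real \<Rightarrow> complex" where
  "rank_dft n x \<tau> \<omega> =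
     (\<Sum>t<n. of_bool (sample_rank n x t \<le> real n * \<tau>) * exp (- \<i> * complex_of_real (\<omega> * real t)))"

definition copula_periodogram :: "nat \<Rightarrow> (nat \<Rightarrow> real) \<Rightarrow> real \<Rightarrow> real \<Rightarrow> real \<Rightarrow> complex" where
  "copula_periodogram n x \<tau>\<^sub>1 \<tau>\<^sub>2 \<omega> =
     complex_of_real (1 / (2 * pi * real n)) * rank_dft n x \<tau>\<^sub>1 \<omega> * rank_dft n x \<tau>\<^sub>2 (- \<omega>)"

definition blomqvist_coeff :: "nat \<Rightarrow> (nat \<Rightarrow> real) \<Rightarrow> int \<Rightarrow> real" where
  "blomqvist_coeff n x k = (1 / real (n - nat \<bar>k\<bar>)) *
     (\<Sum>t<n - nat \<bar>k\<bar>.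
        4 * of_bool (sample_rank n x t \<le> real n / 2 \<and> sample_rank n x (t + nat \<bar>k\<bar>) \<le> real n / 2) - 1)"

definition gini_coeff :: "nat \<Rightarrow> (nat \<Rightarrow> real) \<Rightarrow> int \<Rightarrow> real" where
  "gini_coeff n x k = (2 / (real n * real (n - nat \<bar>k\<bar>))) *
     (\<Sum>t<n - nat \<bar>k\<bar>.
        \<bar>sample_rank n x t + sample_rank n x (t + nat \<bar>k\<bar>) - real n\<bar> - \<bar>sample_rank n x t - sample_rank n x (t + nat \<bar>k\<bar>)\<bar>)"

definition fourier_freqs :: "nat \<Rightarrow> real set" where
  "fourier_freqs n = {2 * pi * real j / real n | j. j \<in> {1..(n - 1) div 2}}"

definition mu_beta :: "(real \<times> real) measure" where
  "mu_beta = scale_measure 4 (return borel (1/2, 1/2))"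

text \<open>The sum of two measures, each the uniform distribution on one diagonal of the unit square
  scaled by 4. That the set function below is indeed a measure is shown in
  \<open>emeasure_mu_Gamma\<close>.\<close>

definition mu_Gamma :: "(real \<times> real) measure" where
  "mu_Gamma = measure_of UNIV (sets borel) (\<lambda>A.
     4 * emeasure (distr (uniform_measure lborel {0..1}) borel (\<lambda>u. (u, u))) A +
     4 * emeasure (distr (uniform_measure lborel {0..1}) borel (\<lambda>u. (u, 1 - u))) A)"

lemma sets_mu_Gamma [simp, measurable_cong]: "sets mu_Gamma = sets borel"
  by (simp add: mu_Gamma_def sets.sigma_sets_eq[of borel, simplified])

lemma emeasure_mu_Gamma:
  assumes "A \<in> sets borel"
  shows "emeasure mu_Gamma A =
     4 * emeasure (distr (uniform_measure lborel {0..1}) borel (\<lambda>u. (u, u))) A +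
     4 * emeasure (distr (uniform_measure lborel {0..1}) borel (\<lambda>u. (u, 1 - u))) A"
proof -
  let ?P = "distr (uniform_measure lborel {0..1::real}) borel (\<lambda>u. (u, u))"
  let ?Q = "distr (uniform_measure lborel {0..1::real}) borel (\<lambda>u. (u, 1 - u))"
  have "countably_additive (sets borel) (\<lambda>A. 4 * emeasure ?P A + 4 * emeasure ?Q A)"
  proof (rule countably_additiveI)
    fix B :: "nat \<Rightarrow> (real \<times> real) set"
    assume B: "range B \<subseteq> sets borel" "disjoint_family B"
    have "(\<Sum>i. emeasure ?P (B i)) = emeasure ?P (\<Union>i. B i)"
         "(\<Sum>i. emeasure ?Q (B i)) = emeasure ?Q (\<Union>i. B i)"
      using B by (auto intro!: suminf_emeasure)
    then show "(\<Sum>i. 4 * emeasure ?P (B i) + 4 * emeasure ?Q (B i)) =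
        4 * emeasure ?P (\<Union>i. B i) + 4 * emeasure ?Q (\<Union>i. B i)"
      by (simp add: suminf_add[symmetric] ennreal_suminf_cmult)
  qed
  then show ?thesis
    using assms
    unfolding mu_Gamma_def
    by (intro emeasure_measure_of_sigma)
       (use sets.sigma_algebra_axioms[of "borel :: (real \<times> real) measure"] in
        \<open>auto simp: positive_def\<close>)
qed

lemma nn_integral_mu_Gamma:
  assumes "g \<in> borel_measurable borel"
  shows "(\<integral>\<^sup>+p. g p \<partial>mu_Gamma) =
    4 * (\<integral>\<^sup>+u\<in>{0..1}. g (u, u) \<partial>lborel) + 4 * (\<integral>\<^sup>+u\<in>{0..1}. g (u, 1 - u) \<partial>lborel)"
proof -
  let ?U = "uniform_measure lborel {0..1::real}"
  let ?P = "distr ?U borel (\<lambda>u. (u, u))"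
  let ?Q = "distr ?U borel (\<lambda>u. (u, 1 - u))"
  have [measurable]: "(\<lambda>u::real. (u, u)) \<in> borel_measurable borel"
    "(\<lambda>u::real. (u, 1 - u)) \<in> borel_measurable borel"
    by (auto intro!: borel_measurable_continuous_onI continuous_intros)
  have "(\<integral>\<^sup>+p. g p \<partial>mu_Gamma) = 4 * (\<integral>\<^sup>+p. g p \<partial>?P) + 4 * (\<integral>\<^sup>+p. g p \<partial>?Q)"
    using assms
  proof (induction g rule: borel_measurable_induct)
    case (cong f g)
    then show ?case by (simp cong: nn_integral_cong)
  next
    case (set A)
    then show ?case
      by (simp add: emeasure_mu_Gamma)
  next
    case (mult u c)
    then show ?case
      by (simp add: nn_integral_cmult distrib_left mult.left_commute)
  next
    case (add u v)
    then show ?case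
      by (simp add: nn_integral_add distrib_left add_ac)
  next
    case (seq U)
    have m: "\<And>i. U i \<in> borel_measurable mu_Gamma" "\<And>i. U i \<in> borel_measurable ?P"
      "\<And>i. U i \<in> borel_measurable ?Q"
      using seq by auto
    have i: "incseq (\<lambda>i. 4 * integral\<^sup>N ?P (U i))" "incseq (\<lambda>i. 4 * integral\<^sup>N ?Q (U i))"
      using seq by (auto simp: incseq_def le_fun_def intro!: mult_left_mono nn_integral_mono)
    show ?case
      using seq m i
      by (simp add: nn_integral_monotone_convergence_SUP ennreal_SUP_add SUP_mult_left_ennreal
           image_comp)
  qed
  moreover have "(\<integral>\<^sup>+p. g p \<partial>?P) = (\<integral>\<^sup>+u\<in>{0..1}. g (u, u) \<partial>lborel)"
    "(\<integral>\<^sup>+p. g p \<partial>?Q) = (\<integral>\<^sup>+u\<in>{0..1}. g (u, 1 - u) \<partial>lborel)"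
    using assms by (simp_all add: nn_integral_distr nn_integral_uniform_measure
        divide_ennreal_def)
  ultimately show ?thesis by simp
qed

end

theory Submission
  imports Defs
begin

text \<open>
  Rescale the ranks to \<open>a t = R t / n\<close>, which lie in \<open>[0,1]\<close>. The periodogram is
  \<open>1/(2 \<pi> n) * \<Sum>s t. e^(\<i> \<omega> (t - s)) I{a s \<le> u, a t \<le> v}\<close>, so integrating it against a finite
  measure replaces each indicator by the mass of \<open>[a s,1] \<times> [a t,1]\<close>. For \<open>mu_beta\<close> this mass is
  \<open>4 I{a s \<le> 1/2, a t \<le> 1/2}\<close>, and for \<open>mu_Gamma\<close> it is
  \<open>2 (\<bar>a s + a t - 1\<bar> - \<bar>a s - a t\<bar>) + 6 - 4 a s - 4 a t\<close>. At a nonzero Fourier frequency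
  \<open>\<Sum>t. e^(\<i> \<omega> t) = 0\<close>, so every summand depending on only one of \<open>s\<close>, \<open>t\<close> drops out of the double
  sum. Grouping what remains by the lag \<open>k = t - s\<close> gives the sample coefficients.
\<close>

section \<open>Grouping by lag and cancellation at Fourier frequencies\<close>

text \<open>Each diagonal \<open>t - s = k\<close> of the index square is parametrised by its
  smaller index. Symmetry of \<open>h\<close> folds lag \<open>-k\<close> onto lag \<open>k\<close>,
  which matches sample coefficients that depend on the absolute value of the lag only.\<close>

lemma sum_by_lag:
  fixes c :: "int \<Rightarrow> complex" and h :: "nat \<Rightarrow> nat \<Rightarrow> complex"
  assumes sym: "\<And>s t. h s t = h t s"
  shows "(\<Sum>s<n. \<Sum>t<n. c (int t - int s) * h s t) =
    (\<Sum>k | \<bar>k\<bar> < int n. c k * (\<Sum>t<n - nat \<bar>k\<bar>. h t (t + nat \<bar>k\<bar>)))"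
proof -
  let ?P = "{..<n} \<times> {..<n}"
  let ?K = "{k. \<bar>k\<bar> < int n}"
  let ?lag = "\<lambda>p. int (snd p) - int (fst p)"
  let ?f = "\<lambda>p. c (?lag p) * h (fst p) (snd p)"
  have "?K = {- int n<..<int n}"
    by auto
  then have finK: "finite ?K"
    by simp
  have lag: "(\<Sum>p\<in>{p \<in> ?P. ?lag p = k}. ?f p) = c k * (\<Sum>t<n - nat \<bar>k\<bar>. h t (t + nat \<bar>k\<bar>))"
    (is "?lhs = _") for k
  proof -
    have "?lhs = (\<Sum>t<n - nat \<bar>k\<bar>. c k * h t (t + nat \<bar>k\<bar>))"
    proof (cases "k \<ge> 0")
      case True
      then show ?thesis
        by (intro sum.reindex_bij_witness[of _ "\<lambda>t. (t, t + nat \<bar>k\<bar>)" fst])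
          (auto simp: nat_diff_distrib)
    next
      case False
      then show ?thesis
        \<comment> \<open>For a negative lag the first index is the larger one, so the pair appears
          swapped and \<open>sym\<close> restores the order.\<close>
        by (intro sum.reindex_bij_witness[of _ "\<lambda>t. (t + nat \<bar>k\<bar>, t)" snd])
          (auto simp: nat_diff_distrib sym)
    qed
    then show ?thesis
      by (simp add: sum_distrib_left)
  qed
  have "(\<Sum>s<n. \<Sum>t<n. c (int t - int s) * h s t) = (\<Sum>p\<in>?P. ?f p)"
    by (simp add: sum.cartesian_product case_prod_beta)
  also have "\<dots> = (\<Sum>k\<in>?K. \<Sum>p\<in>{p \<in> ?P. ?lag p = k}. ?f p)"
    by (rule sum.group[symmetric]) (use finK in auto)
  finally show ?thesis
    by (simp only: lag)
qed

text \<open>The summands are the powers of an \<open>n\<close>-th root of unity \<open>z\<close>,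
  and \<open>z\<close> differs from 1 because \<open>0 < j < n\<close>, so the geometric sum
  vanishes.\<close>

lemma sum_exp_fourier_freq:
  assumes "\<omega> \<in> fourier_freqs n"
  shows "(\<Sum>t<n. exp (\<i> * complex_of_real (\<omega> * real t))) = 0"
proof -
  obtain j where w: "\<omega> = 2 * pi * real j / real n" and j: "1 \<le> j" "j \<le> (n - 1) div 2"
    using assms by (auto simp: fourier_freqs_def)
  have n: "0 < n" "j < n"
    using j by linarith+
  define z where "z = exp (\<i> * complex_of_real \<omega>)"
  have pow: "exp (\<i> * complex_of_real (\<omega> * real t)) = z ^ t" for t
    by (simp add: z_def exp_of_nat_mult[symmetric] mult_ac)
  have "z \<noteq> 1"
  proof
    assume "z = 1"
    then obtain m :: int where "\<omega> = 2 * of_int m * pi"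
      by (auto simp: z_def exp_eq_1)
    then have "real j = of_int m * real n"
      using w n by (simp add: field_simps)
    then have "int j = m * int n"
      by (metis of_int_eq_iff of_int_mult of_int_of_nat_eq)
    then have "int n dvd int j"
      by simp
    then show False
      using j n by (auto dest: zdvd_imp_le)
  qed
  moreover have "z ^ n = 1"
  proof -
    have "z ^ n = exp (\<i> * complex_of_real (2 * pi * real j))"
      using n by (simp add: pow[symmetric] w)
    also have "\<dots> = 1"
      by (subst exp_eq_1) (auto intro!: exI[of _ "int j"])
    finally show ?thesis .
  qed
  ultimately show ?thesis
    unfolding pow by (subst geometric_sum) simp_all
qed

text \<open>The kernel factorises as \<open>e t * cnj (e s)\<close>. A term in \<open>s\<close>
  alone leaves a free sum of \<open>e t\<close>, a term in \<open>t\<close> alone leaves the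
  conjugate sum, and both are zero.\<close>

lemma fourier_double_sum_drop_marginals:
  fixes h :: "nat \<Rightarrow> nat \<Rightarrow> complex" and f g :: "nat \<Rightarrow> complex"
  assumes "\<omega> \<in> fourier_freqs n"
  defines "e \<equiv> \<lambda>k::int. exp (\<i> * complex_of_real (\<omega> * real_of_int k))"
  shows "(\<Sum>s<n. \<Sum>t<n. e (int t - int s) * (h s t + f s + g t)) =
    (\<Sum>s<n. \<Sum>t<n. e (int t - int s) * h s t)"
proof -
  have e: "e (int t - int s) = e (int t) * cnj (e (int s))" for s t
    by (simp add: e_def exp_cnj exp_add[symmetric] algebra_simps)
  have z: "(\<Sum>t<n. e (int t)) = 0"
    using sum_exp_fourier_freq[OF assms(1)] by (simp add: e_def)
  then have zc: "(\<Sum>t<n. cnj (e (int t))) = 0"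
    by (metis cnj_sum complex_cnj_zero)
  have "(\<Sum>s<n. \<Sum>t<n. e (int t - int s) * f s) = (\<Sum>s<n. (\<Sum>t<n. e (int t)) * (cnj (e (int s)) * f s))"
    unfolding e sum_distrib_right by (simp add: mult_ac)
  moreover have "(\<Sum>s<n. \<Sum>t<n. e (int t - int s) * g t) =
      (\<Sum>t<n. (\<Sum>s<n. cnj (e (int s))) * (e (int t) * g t))"
    by (subst sum.swap) (simp add: e sum_distrib_left sum_distrib_right mult_ac)
  ultimately show ?thesis
    by (simp add: z zc distrib_left sum.distrib)
qed

section \<open>Bounds on the ranks and the integrated periodogram\<close>

lemma sample_rank_nonneg: "0 \<le> sample_rank n x t"
  by (simp add: sample_rank_def ecdf_def sum_nonneg)

lemma sample_rank_le: "sample_rank n x t \<le> real n"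
proof -
  have "(\<Sum>s<n. of_bool (x s \<le> x t)) \<le> (\<Sum>s<n. 1 :: real)"
    by (rule sum_mono) simp
  then show ?thesis
    by (cases "n = 0") (simp_all add: sample_rank_def ecdf_def)
qed

text \<open>For fixed data the integrand is a finite linear combination of indicators of rectangles
  in \<open>(u, v)\<close>; these are integrable because \<open>m\<close> is finite. Both measures
  are instances.\<close>

lemma integral_copula_periodogram:
  fixes m :: "(real \<times> real) measure"
  assumes "finite_measure m" and [measurable_cong]: "sets m = sets borel" and n: "n > 0"
  shows "(LINT (u, v) : {0..1} \<times> {0..1} | m. copula_periodogram n x u v \<omega>) =
    complex_of_real (1 / (2 * pi * real n)) *
    (\<Sum>s<n. \<Sum>t<n. exp (\<i> * complex_of_real (\<omega> * real_of_int (int t - int s))) *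
      complex_of_real (measure m
        ({sample_rank n x s / real n..1} \<times> {sample_rank n x t / real n..1})))"
proof -
  interpret finite_measure m
    by fact
  define c where "c = complex_of_real (1 / (2 * pi * real n))"
  define e where "e = (\<lambda>s t. exp (\<i> * complex_of_real (\<omega> * real_of_int (int t - int s))))"
  define a where "a = (\<lambda>t. sample_rank n x t / real n)"
  define R where "R = (\<lambda>s t. {a s..1} \<times> {a t..1})"
  have a: "0 \<le> a t" "(sample_rank n x t \<le> real n * u) = (a t \<le> u)" for t u
    using n by (auto simp: a_def sample_rank_nonneg field_simps)
  \<comment> \<open>The second transform is taken at the negated frequency, so its phase has the
    opposite sign and the product depends on \<open>t - s\<close> only.\<close>
  have ee: "exp (- \<i> * complex_of_real (\<omega> * real s)) * exp (- \<i> * complex_of_real (- \<omega> * real t)) = e s t"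
    for s t
    by (simp add: e_def exp_add[symmetric] algebra_simps)
  have R: "R s t \<in> sets m" for s t
    unfolding assms(2) by (intro borel_closed) (simp add: R_def closed_Times)
  have "indicat_real ({0..1} \<times> {0..1}) p *\<^sub>R (case p of (u, v) \<Rightarrow> copula_periodogram n x u v \<omega>) =
      c * (\<Sum>s<n. \<Sum>t<n. e s t * complex_of_real (indicat_real (R s t) p))" for p
  proof -
    obtain u v where p: "p = (u, v)"
      by fastforce
    have "copula_periodogram n x u v \<omega> =
        c * (\<Sum>s<n. \<Sum>t<n. e s t * (of_bool (a s \<le> u) * of_bool (a t \<le> v)))"
      unfolding copula_periodogram_def rank_dft_def mult.assoc c_def a sum_product
        ee[symmetric] by (simp add: mult_ac)
    \<comment> \<open>The quadrant with corner \<open>(a s, a t)\<close> meets the unit square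
      exactly in \<open>R s t\<close>, since both coordinates of the corner are nonnegative.\<close>
    moreover have "complex_of_real (indicat_real ({0..1} \<times> {0..1}) p) *
        (of_bool (a s \<le> u) * of_bool (a t \<le> v)) = complex_of_real (indicat_real (R s t) p)" for s t
      using a(1)[of s] a(1)[of t] by (auto simp: p R_def indicator_def)
    ultimately show ?thesis
      by (simp add: p scaleR_conv_of_real sum_distrib_left mult.left_commute)
  qed
  then have "(LINT (u, v) : {0..1} \<times> {0..1} | m. copula_periodogram n x u v \<omega>) =
      (LINT p|m. c * (\<Sum>s<n. \<Sum>t<n. e s t * complex_of_real (indicat_real (R s t) p)))"
    by (simp add: set_lebesgue_integral_def)
  also have "\<dots> = c * (\<Sum>s<n. \<Sum>t<n. e s t * complex_of_real (measure m (R s t)))"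
    using R sets.sets_into_space[OF R]
    by (simp add: integrable_indicator_iff Int_absorb2 emeasure_eq_measure)
  finally show ?thesis
    by (simp add: c_def e_def R_def a_def)
qed

section \<open>Masses of upper-right rectangles under the two measures\<close>

lemma sets_mu_beta: "sets mu_beta = sets borel"
  by (simp add: mu_beta_def)

lemma mu_beta_rectangle:
  assumes "a \<le> 1" "b \<le> 1"
  shows "measure mu_beta ({a..1} \<times> {b..1}) = 4 * of_bool (a \<le> 1/2 \<and> b \<le> 1/2)"
proof -
  have "{a..1} \<times> {b..1} \<in> sets (borel :: (real \<times> real) measure)"
    by (intro borel_closed closed_Times) auto
  then show ?thesis
    by (auto simp: mu_beta_def measure_def indicator_def)
qed

lemma finite_measure_mu_beta: "finite_measure mu_beta"
  by (rule finite_measureI)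
    (simp add: sets_eq_imp_space_eq[OF sets_mu_beta], simp add: mu_beta_def ennreal_mult_eq_top_iff)

lemma finite_measure_mu_Gamma: "finite_measure mu_Gamma"
proof (rule finite_measureI)
  interpret U: prob_space "uniform_measure lborel {0..1::real}"
    by (rule prob_space_uniform_measure) auto
  have "emeasure mu_Gamma UNIV \<noteq> \<infinity>"
    by (subst emeasure_mu_Gamma) (auto simp: emeasure_distr ennreal_mult_eq_top_iff)
  then show "emeasure mu_Gamma (space mu_Gamma) \<noteq> \<infinity>"
    by (simp add: sets_eq_imp_space_eq[OF sets_mu_Gamma])
qed

text \<open>The main diagonal meets the rectangle for \<open>u\<close> in
  \<open>{max a b..1}\<close>, the antidiagonal for \<open>u\<close> in \<open>{a..1 - b}\<close>;
  each contributes 4 times the length.\<close>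

lemma mu_Gamma_rectangle:
  assumes "0 \<le> a" "a \<le> 1" "0 \<le> b" "b \<le> 1"
  shows "measure mu_Gamma ({a..1} \<times> {b..1}) = 2 * (\<bar>a + b - 1\<bar> - \<bar>a - b\<bar>) + 6 - 4 * a - 4 * b"
proof -
  have [measurable]: "(\<lambda>u::real. (u, u)) \<in> borel_measurable borel"
    "(\<lambda>u::real. (u, 1 - u)) \<in> borel_measurable borel"
    by (auto intro!: borel_measurable_continuous_onI continuous_intros)
  have R: "{a..1} \<times> {b..1} \<in> sets (borel :: (real \<times> real) measure)"
    by (intro borel_closed closed_Times) auto
  have 1: "{0..1} \<inter> ((\<lambda>u. (u, u)) -` ({a..1} \<times> {b..1}) \<inter> UNIV) = {max a b..1}"
    and 2: "{0..1} \<inter> ((\<lambda>u. (u, 1 - u)) -` ({a..1} \<times> {b..1}) \<inter> UNIV) = {a..1 - b}"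
    using assms by auto
  have m: "(\<lambda>u. (u, u)) -` ({a..1} \<times> {b..1}) \<inter> UNIV \<in> sets borel"
    "(\<lambda>u. (u, 1 - u)) -` ({a..1} \<times> {b..1}) \<inter> UNIV \<in> sets borel"
    using R by measurable
  have add: "4 * ennreal p + 4 * ennreal q = ennreal (4 * p + 4 * q)" if "0 \<le> p" "0 \<le> q" for p q
    using that by (simp add: ennreal_plus ennreal_mult)
  have "emeasure mu_Gamma ({a..1} \<times> {b..1}) =
      4 * emeasure lborel {max a b..1} + 4 * emeasure lborel {a..1 - b}"
    using R m by (simp add: emeasure_mu_Gamma emeasure_distr 1[simplified] 2[simplified] divide_ennreal_def)
  \<comment> \<open>The antidiagonal misses the rectangle when \<open>a + b > 1\<close>, hence the
    truncation at 0.\<close>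
  also have "\<dots> = 4 * ennreal (1 - max a b) + 4 * ennreal (max 0 (1 - a - b))"
    using assms by (auto simp: emeasure_lborel_Icc_eq max_def algebra_simps)
  also have "\<dots> = ennreal (4 * (1 - max a b) + 4 * max 0 (1 - a - b))"
    using add[of "1 - max a b" "max 0 (1 - a - b)"] assms by simp
  finally have "measure mu_Gamma ({a..1} \<times> {b..1}) = 4 * (1 - max a b) + 4 * max 0 (1 - a - b)"
    using assms by (intro measure_eq_emeasure_eq_ennreal add_nonneg_nonneg) auto
  \<comment> \<open>This is \<open>max p q = (p + q + abs (p - q)) / 2\<close> applied to both
    maxima.\<close>
  then show ?thesis
    by (auto simp: max_def abs_if)
qed

section \<open>From rectangle masses to sample coefficients\<close>

text \<open>The argument common to both coefficients: \<open>f\<close> and \<open>g\<close> collect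
  the part of the rectangle mass that cancels at a Fourier frequency, while the symmetric part
  \<open>h\<close> survives and yields the coefficient \<open>r\<close>.\<close>

lemma integral_periodogram_eq_lag_sum:
  fixes h :: "real \<Rightarrow> real \<Rightarrow> real" and f g :: "real \<Rightarrow> real"
  assumes w: "\<omega> \<in> fourier_freqs n"
    and m: "finite_measure m" "sets m = sets borel"
    and sym: "\<And>a b. h a b = h b a"
    and rectangle: "\<And>a b. 0 \<le> a \<Longrightarrow> a \<le> 1 \<Longrightarrow> 0 \<le> b \<Longrightarrow> b \<le> 1 \<Longrightarrow>
      measure m ({a..1} \<times> {b..1}) = h a b + f a + g b"
    and coeff: "\<And>k. \<bar>k\<bar> < int n \<Longrightarrow> (real n - real_of_int \<bar>k\<bar>) * r k =
      (\<Sum>t<n - nat \<bar>k\<bar>. h (sample_rank n x t / real n) (sample_rank n x (t + nat \<bar>k\<bar>) / real n))"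
  shows "(LINT (u, v) : {0..1} \<times> {0..1} | m. copula_periodogram n x u v \<omega>) =
      complex_of_real (1 / (2 * pi)) *
      (\<Sum>k | \<bar>k\<bar> < int n. complex_of_real ((real n - real_of_int \<bar>k\<bar>) / real n) *
         exp (\<i> * complex_of_real (\<omega> * real_of_int k)) * complex_of_real (r k))"
proof -
  \<comment> \<open>For \<open>n = 0\<close> truncated subtraction gives
    \<open>(n - 1) div 2 = 0\<close>, so there would be no frequency.\<close>
  have n: "n > 0"
    using w by (auto simp: fourier_freqs_def intro: gr0I)
  define a where "a = (\<lambda>t. sample_rank n x t / real n)"
  have a_eq: "sample_rank n x t / real n = a t" for t
    by (simp add: a_def)
  have a: "0 \<le> a t" "a t \<le> 1" for t
    using n by (simp_all add: a_def sample_rank_nonneg sample_rank_le)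
  define e where "e = (\<lambda>k::int. exp (\<i> * complex_of_real (\<omega> * real_of_int k)))"
  have "(LINT (u, v) : {0..1} \<times> {0..1} | m. copula_periodogram n x u v \<omega>) =
      complex_of_real (1 / (2 * pi * real n)) * (\<Sum>s<n. \<Sum>t<n. e (int t - int s) *
        (complex_of_real (h (a s) (a t)) + complex_of_real (f (a s)) + complex_of_real (g (a t))))"
    unfolding integral_copula_periodogram[OF m n] e_def a_eq
    by (simp add: rectangle a)
  also have "\<dots> = complex_of_real (1 / (2 * pi * real n)) *
      (\<Sum>s<n. \<Sum>t<n. e (int t - int s) * complex_of_real (h (a s) (a t)))"
    unfolding e_def by (subst fourier_double_sum_drop_marginals[OF w]) simp
  also have "\<dots> = complex_of_real (1 / (2 * pi * real n)) *
      (\<Sum>k | \<bar>k\<bar> < int n. e k * (\<Sum>t<n - nat \<bar>k\<bar>. complex_of_real (h (a t) (a (t + nat \<bar>k\<bar>)))))"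
    by (subst sum_by_lag) (simp_all add: sym)
  also have "\<dots> = complex_of_real (1 / (2 * pi * real n)) *
      (\<Sum>k | \<bar>k\<bar> < int n. e k * complex_of_real ((real n - real_of_int \<bar>k\<bar>) * r k))"
    by (intro arg_cong2[of _ _ _ _ "(*)"] refl sum.cong) (simp_all only: coeff a_def mem_Collect_eq of_real_sum)
  finally show ?thesis
    by (simp add: e_def sum_distrib_left mult_ac)
qed

theorem proposition4p4:
  fixes M :: "'a measure" and X :: "int \<Rightarrow> 'a \<Rightarrow> real" and n :: nat and \<omega> :: real
  assumes "prob_space M"
    and "strictly_stationary M X"
    and "continuous_on UNIV (cdf (distr M borel (X 0)))"
    and "\<omega> \<in> fourier_freqs n"
  shows "\<forall>w\<in>space M. let x = (\<lambda>t::nat. X (int t) w) in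
    (LINT (u, v) : {0..1} \<times> {0..1} | mu_beta. copula_periodogram n x u v \<omega>) =
      complex_of_real (1 / (2 * pi)) *
      (\<Sum>k | \<bar>k\<bar> < int n. complex_of_real ((real n - real_of_int \<bar>k\<bar>) / real n) *
         exp (\<i> * complex_of_real (\<omega> * real_of_int k)) * complex_of_real (blomqvist_coeff n x k)) \<and>
    (LINT (u, v) : {0..1} \<times> {0..1} | mu_Gamma. copula_periodogram n x u v \<omega>) =
      complex_of_real (1 / (2 * pi)) *
      (\<Sum>k | \<bar>k\<bar> < int n. complex_of_real ((real n - real_of_int \<bar>k\<bar>) / real n) *
         exp (\<i> * complex_of_real (\<omega> * real_of_int k)) * complex_of_real (gini_coeff n x k))"
proof (unfold Let_def, intro ballI conjI)
  fix w
  define x where "x = (\<lambda>t::nat. X (int t) w)"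
  have n: "n > 0"
    using assms(4) by (auto simp: fourier_freqs_def intro: gr0I)
  \<comment> \<open>At these lags the natural subtraction is exact and nonzero, so the weight
    cancels the normalisation of either coefficient.\<close>
  have lag: "real (n - nat \<bar>k\<bar>) = real n - real_of_int \<bar>k\<bar>" "real n - real_of_int \<bar>k\<bar> \<noteq> 0"
    if "\<bar>k\<bar> < int n" for k
    using that by linarith+
  show "(LINT (u, v) : {0..1} \<times> {0..1} | mu_beta. copula_periodogram n (\<lambda>t. X (int t) w) u v \<omega>) =
      complex_of_real (1 / (2 * pi)) *
      (\<Sum>k | \<bar>k\<bar> < int n. complex_of_real ((real n - real_of_int \<bar>k\<bar>) / real n) *
         exp (\<i> * complex_of_real (\<omega> * real_of_int k)) *
         complex_of_real (blomqvist_coeff n (\<lambda>t. X (int t) w) k))"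
    unfolding x_def[symmetric]
  \<comment> \<open>The constant \<open>f = 1\<close> makes up for the \<open>- 1\<close> in the
    Blomqvist summand, which the rectangle mass does not contain.\<close>
  proof (rule integral_periodogram_eq_lag_sum[where f = "\<lambda>_. 1" and g = "\<lambda>_. 0" and
        h = "\<lambda>a b. 4 * of_bool (a \<le> 1/2 \<and> b \<le> 1/2) - 1"])
    fix k assume k: "\<bar>k\<bar> < int n"
    have half: "sample_rank n x t / real n \<le> 1/2 \<longleftrightarrow> sample_rank n x t \<le> real n / 2" for t
      using n by (simp add: field_simps)
    show "(real n - real_of_int \<bar>k\<bar>) * blomqvist_coeff n x k =
      (\<Sum>t<n - nat \<bar>k\<bar>. 4 * of_bool (sample_rank n x t / real n \<le> 1/2 \<and>
        sample_rank n x (t + nat \<bar>k\<bar>) / real n \<le> 1/2) - 1)"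
      unfolding half blomqvist_coeff_def lag(1)[OF k] using lag(2)[OF k] by simp
  qed (use assms(4) finite_measure_mu_beta in \<open>auto simp: mu_beta_rectangle sets_mu_beta\<close>)
  show "(LINT (u, v) : {0..1} \<times> {0..1} | mu_Gamma. copula_periodogram n (\<lambda>t. X (int t) w) u v \<omega>) =
      complex_of_real (1 / (2 * pi)) *
      (\<Sum>k | \<bar>k\<bar> < int n. complex_of_real ((real n - real_of_int \<bar>k\<bar>) / real n) *
         exp (\<i> * complex_of_real (\<omega> * real_of_int k)) *
         complex_of_real (gini_coeff n (\<lambda>t. X (int t) w) k))"
    unfolding x_def[symmetric]
  proof (rule integral_periodogram_eq_lag_sum[where f = "\<lambda>a. 6 - 4 * a" and g = "\<lambda>b. - 4 * b" and
        h = "\<lambda>a b. 2 * (\<bar>a + b - 1\<bar> - \<bar>a - b\<bar>)"])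
    fix k assume k: "\<bar>k\<bar> < int n"
    \<comment> \<open>Taking \<open>1 / n\<close> out of each absolute value turns \<open>h\<close>
      at rescaled ranks into the Gini summand with its prefactor \<open>2 / n\<close>.\<close>
    have scale: "2 * (\<bar>p / real n + q / real n - 1\<bar> - \<bar>p / real n - q / real n\<bar>) =
        2 / real n * (\<bar>p + q - real n\<bar> - \<bar>p - q\<bar>)" for p q
    proof -
      have "\<bar>p / real n + q / real n - 1\<bar> = \<bar>(p + q - real n) / real n\<bar>"
        "\<bar>p / real n - q / real n\<bar> = \<bar>(p - q) / real n\<bar>"
        using n by (simp_all add: field_simps)
      then show ?thesis
        unfolding abs_divide by (simp add: algebra_simps)
    qed
    show "(real n - real_of_int \<bar>k\<bar>) * gini_coeff n x k =
      (\<Sum>t<n - nat \<bar>k\<bar>. 2 * (\<bar>sample_rank n x t / real n + sample_rank n x (t + nat \<bar>k\<bar>) / real n - 1\<bar> -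
        \<bar>sample_rank n x t / real n - sample_rank n x (t + nat \<bar>k\<bar>) / real n\<bar>))"
      unfolding scale gini_coeff_def lag(1)[OF k] sum_distrib_left[symmetric] using lag(2)[OF k] by simp
  qed (use assms(4) finite_measure_mu_Gamma in \<open>auto simp: mu_Gamma_rectangle abs_minus_commute add.commute\<close>)
qed

end
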